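(* Let $K:SO(3)\times SO(3)\to\mathbb{R}$ be of the form $K(R,Q)=g(d(R,Q)^2)$ with $g:[0,\infty)\to\mathbb{R}$ differentiable with locally Lipschitz continuous derivative, and let $0<r<\pi/4$ be fixed. Let $N$ be a positive integer. Suppose that: (i) $g'$ is continuously differentiable on $[0,4r^2]$ and satisfies $g'(s)\geq c\,s^\alpha$ for all $s\in[0,4r^2]$, for some $c>0$ and $\alpha\geq0$; (ii) the initial points satisfy $R_i^0\in\overline{D}_r$ for $i=1,\dots,N$. Let $(R_i(t))_{i=1}^N$ be the global solution to $$\dot R_i=-\frac1N\sum_{j=1}^N\nabla K_{R_j}(R_i),\quad t>0,\qquad R_i(0)=R_i^0.$$ Then $\lim_{t\to\infty}d(R_i(t),R_j(t))=0$ for all $i,j\in\{1,\dots,N\}$.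
   Context: $SO(3)$ is the group of $3\times3$ rotation matrices, with $T_RSO(3)=\{RA: A\in\mathbb{R}^{3\times3},\ A^T=-A\}$ and Riemannian metric $RA_1\cdot RA_2=\frac12\langle A_1,A_2\rangle_F$ ($\langle\cdot,\cdot\rangle_F$ is the Frobenius inner product). $d$ is the geodesic distance, $d(R,Q)=\arccos\big(\frac{\mathrm{tr}(R^TQ)-1}{2}\big)$, and $\nabla$ is the Riemannian gradient on $SO(3)$. $D_r=\{Q\in SO(3): d(I,Q)<r\}$ and $\overline{D}_r$ is its closure. $K_Q(R)=K(R,Q)$, and $\nabla K_Q(R)$ is the gradient in $R$; explicitly $\nabla K_Q(R)=-2g'(d(R,Q)^2)\log_RQ$ where $\log_RQ=R\log(R^TQ)$ is the Riemannian logarithm (for $d(R,Q)<\pi$). The global solution is the unique family of trajectories $R_i:[0,\infty)\to\overline{D}_r$ solving the system (its global well-posedness and the invariance of $\overline{D}_r$ are established elsewhere in the paper). *)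

theory Defs
  imports "HOL-Analysis.Analysis"
begin

definition SO3 :: "(real^3^3) set" where
  "SO3 = {R. orthogonal_matrix R \<and> det R = 1}"

definition so3_tangent :: "real^3^3 \<Rightarrow> (real^3^3) set" where
  "so3_tangent R = {R ** A | A. transpose A = - A}"

text \<open>The inner product of the type \<^typ>\<open>real^3^3\<close> is the Frobenius inner product.
  For \<open>V = R ** A1\<close> and \<open>W = R ** A2\<close> with \<open>R\<close> orthogonal, \<open>transpose R ** V = A1\<close> and
  \<open>transpose R ** W = A2\<close>.\<close>

definition so3_metric :: "real^3^3 \<Rightarrow> real^3^3 \<Rightarrow> real^3^3 \<Rightarrow> real" where
  "so3_metric R V W = (1/2) * ((transpose R ** V) \<bullet> (transpose R ** W))"

definition so3_dist :: "real^3^3 \<Rightarrow> real^3^3 \<Rightarrow> real" where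
  "so3_dist R Q = arccos ((trace (transpose R ** Q) - 1) / 2)"

definition so3_disk :: "real \<Rightarrow> (real^3^3) set" where
  "so3_disk r = {Q \<in> SO3. so3_dist (mat 1) Q < r}"

text \<open>The differential of \<open>f\<close> at a point \<open>R\<close> of the embedded submanifold \<^const>\<open>SO3\<close> is the
  restriction to the tangent space at \<open>R\<close> of a derivative of \<open>f\<close> at \<open>R\<close> within \<^const>\<open>SO3\<close>;
  such a derivative is determined only on the tangent space. Only the values of \<open>f\<close> on
  \<^const>\<open>SO3\<close> matter.\<close>

definition has_so3_gradient :: "(real^3^3 \<Rightarrow> real) \<Rightarrow> real^3^3 \<Rightarrow> real^3^3 \<Rightarrow> bool" where
  "has_so3_gradient f G R \<longleftrightarrow>
     G \<in> so3_tangent R \<and>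
     (\<exists>f'. (f has_derivative f') (at R within SO3) \<and>
           (\<forall>V \<in> so3_tangent R. f' V = so3_metric R G V))"

definition so3_gradient :: "(real^3^3 \<Rightarrow> real) \<Rightarrow> real^3^3 \<Rightarrow> real^3^3" where
  "so3_gradient f R = (THE G. has_so3_gradient f G R)"

definition locally_lipschitz_on :: "real set \<Rightarrow> (real \<Rightarrow> real) \<Rightarrow> bool" where
  "locally_lipschitz_on S f \<longleftrightarrow>
     (\<forall>x\<in>S. \<exists>u>0. \<exists>L. L-lipschitz_on (cball x u \<inter> S) f)"

text \<open>Derivatives are relative to \<open>S\<close>, hence one-sided at the endpoints of an interval.\<close>

definition continuously_differentiable_on :: "real set \<Rightarrow> (real \<Rightarrow> real) \<Rightarrow> bool" where
  "continuously_differentiable_on S f \<longleftrightarrow>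
     (\<exists>f'. (\<forall>x\<in>S. (f has_real_derivative f' x) (at x within S)) \<and> continuous_on S f')"

text \<open>Real powers of nonnegative reals with \<open>0\<^sup>0 = 1\<close>, whereas \<open>0 powr 0 = 0\<close>.\<close>

definition real_power :: "real \<Rightarrow> real \<Rightarrow> real" where
  "real_power s a = (if a = 0 then 1 else s powr a)"

text \<open>In the closure of \<open>so3_disk r\<close>, taken in \<^typ>\<open>real^3^3\<close>, all points are rotations because
  \<^const>\<open>SO3\<close> is closed.\<close>

definition global_solution ::
  "(real^3^3 \<Rightarrow> real^3^3 \<Rightarrow> real) \<Rightarrow> real \<Rightarrow> nat \<Rightarrow> (nat \<Rightarrow> real^3^3) \<Rightarrow>
   (nat \<Rightarrow> real \<Rightarrow> real^3^3) \<Rightarrow> bool" where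
  "global_solution K r N R0 R \<longleftrightarrow>
     (\<forall>i\<in>{1..N}.
        R i 0 = R0 i \<and>
        continuous_on {0..} (R i) \<and>
        (\<forall>t\<ge>0. R i t \<in> closure (so3_disk r)) \<and>
        (\<forall>t>0. (R i has_vector_derivative
           - ((1 / real N) *\<^sub>R (\<Sum>j=1..N. so3_gradient (\<lambda>X. K X (R j t)) (R i t)))) (at t)))"

end

theory Submission
  imports Defs "HOL-Real_Asymp.Real_Asymp"
begin

text \<open>The diameter of the configuration decreases to \<open>0\<close>. By the explicit gradient
(\<open>so3_gradient_kernel\<close>), \<open>R i\<close> moves with velocity
\<open>(1/N) (\<Sum>k. w i k * so3_pull (R i) (R k))\<close>, where the weights
\<open>w i k = g'(\<theta>\<^sup>2) * \<theta> / sin \<theta>\<close>, with \<open>\<theta> = d(R i, R k)\<close>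
(and \<open>g'(0)\<close> if \<open>\<theta> = 0\<close>), are nonnegative and \<open>so3_pull X Y\<close>
points from \<open>X\<close> towards \<open>Y\<close>. All pairwise distances are at most \<open>2 * r < pi/2\<close>
(\<open>SO3_inner_ge\<close>).

Let \<open>i\<close>, \<open>j\<close> be a pair at maximal distance. In a triangle with sides below \<open>pi/2\<close> both
angles adjacent to a longest side are at most \<open>pi/2\<close>, so that each \<open>R k\<close> pulls \<open>R i\<close> closer to \<open>R j\<close>,
or at least not away from it (\<open>SO3_trace_compare\<close>, \<open>inner_so3_pull_nonneg\<close>). The term \<open>k = j\<close> pulls
strictly, at a rate that the growth condition on \<open>g'\<close> bounds below as long as the distance is
not small (\<open>weighted_pull_lower_bound\<close>).

The distance is measured by the Frobenius inner product \<open>X \<bullet> Y = 1 + 2 * cos (d(X, Y))\<close>, a smooth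
function of the two points. The minimum of \<open>R i \<bullet> R j\<close> over all pairs then grows at
least linearly until it reaches any given level between \<open>1\<close> and \<open>3\<close> (\<open>family_min_growth\<close>), and
hence tends to \<open>3\<close>.

Inequalities between rotations are proved by lifting them to unit quaternions, where
\<open>X \<bullet> Y = 4 * (p \<bullet> q)\<^sup>2 - 1\<close>.\<close>

section \<open>Rotations and unit quaternions\<close>

text \<open>The matrix of \<open>v \<mapsto> q v q\<^sup>*\<close> on the imaginary quaternions, for the quaternion
\<open>q\<close> whose real part is \<open>q$1\<close> and whose imaginary part is \<open>(q$2, q$3, q$4)\<close>. It is defined for
every \<open>q\<close> and is a rotation when \<open>q\<close> is a unit quaternion; \<open>q\<close> and \<open>- q\<close> give the same
matrix.\<close>
definition quat_rotation :: "real^4 \<Rightarrow> real^3^3" where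
  "quat_rotation q = vector
     [vector [(q$1)\<^sup>2 + (q$2)\<^sup>2 - (q$3)\<^sup>2 - (q$4)\<^sup>2,
              2 * (q$2 * q$3 - q$1 * q$4), 2 * (q$2 * q$4 + q$1 * q$3)],
      vector [2 * (q$2 * q$3 + q$1 * q$4),
              (q$1)\<^sup>2 - (q$2)\<^sup>2 + (q$3)\<^sup>2 - (q$4)\<^sup>2, 2 * (q$3 * q$4 - q$1 * q$2)],
      vector [2 * (q$2 * q$4 - q$1 * q$3), 2 * (q$3 * q$4 + q$1 * q$2),
              (q$1)\<^sup>2 - (q$2)\<^sup>2 - (q$3)\<^sup>2 + (q$4)\<^sup>2]]"

lemma inner_mat3: "(A::real^3^3) \<bullet> B = (\<Sum>i\<in>UNIV. \<Sum>j\<in>UNIV. A$i$j * B$i$j)"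
  by (simp add: inner_vec_def)

lemma trace_transpose_mult: "trace (transpose (A::real^3^3) ** B) = A \<bullet> B"
  unfolding inner_mat3 trace_def transpose_def matrix_matrix_mult_def
  by (simp add: sum_3)

text \<open>For unit quaternions \<open>p\<close> and \<open>q\<close> the left-hand side is \<open>1 + 2 * cos \<theta>\<close> with \<open>\<theta>\<close> the distance
of the two rotations, and \<open>p \<bullet> q\<close> is \<open>cos (\<theta>/2)\<close> up to sign. All geometric inequalities
below are read off from this identity.\<close>
lemma inner_quat_rotation:
  "quat_rotation p \<bullet> quat_rotation q = 4 * (p \<bullet> q)\<^sup>2 - (p \<bullet> p) * (q \<bullet> q)"
  unfolding inner_mat3 inner_vec_def[of p] inner_vec_def[of q] quat_rotation_def
  by (simp add: sum_3 sum_4) algebra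

text \<open>Normalizing the matrix instead of the quaternion avoids square roots.\<close>
lemma SO3_quat_rotation_scaled:
  assumes "q \<noteq> 0"
  shows "(1 / (q \<bullet> q)) *\<^sub>R quat_rotation q \<in> SO3"
proof -
  have n: "q \<bullet> q \<noteq> 0" using assms by simp
  have qq: "q \<bullet> q = (q$1)\<^sup>2 + (q$2)\<^sup>2 + (q$3)\<^sup>2 + (q$4)\<^sup>2"
    by (simp add: inner_vec_def sum_4 power2_eq_square)
  have "transpose (quat_rotation q) ** quat_rotation q = (q \<bullet> q)\<^sup>2 *\<^sub>R mat 1"
    unfolding vec_eq_iff qq
    by (simp add: forall_3 transpose_def matrix_matrix_mult_def sum_3 mat_def quat_rotation_def)
       (intro conjI; algebra)
  moreover have "det (quat_rotation q) = (q \<bullet> q)^3"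
    unfolding qq det_3 quat_rotation_def by simp algebra
  moreover have "transpose ((1 / (q \<bullet> q)) *\<^sub>R quat_rotation q) ** ((1 / (q \<bullet> q)) *\<^sub>R quat_rotation q)
      = (1 / (q \<bullet> q))\<^sup>2 *\<^sub>R (transpose (quat_rotation q) ** quat_rotation q)"
    by (simp add: transpose_scalar scalar_matrix_assoc[symmetric] matrix_scalar_ac power2_eq_square)
  moreover have "det ((1 / (q \<bullet> q)) *\<^sub>R quat_rotation q) = (1 / (q \<bullet> q))^3 * det (quat_rotation q)"
    by (simp add: det_3 power3_eq_cube algebra_simps)
  ultimately show ?thesis
    using n by (simp add: SO3_def orthogonal_matrix power_divide)
qed

lemma SO3_mult: "A \<in> SO3 \<Longrightarrow> B \<in> SO3 \<Longrightarrow> A ** B \<in> SO3"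
  by (simp add: SO3_def orthogonal_matrix_mul det_mul)

lemma SO3_transpose: "A \<in> SO3 \<Longrightarrow> transpose A \<in> SO3"
  by (simp add: SO3_def)

lemma SO3_transpose_mult: "A \<in> SO3 \<Longrightarrow> transpose A ** A = mat 1" "A \<in> SO3 \<Longrightarrow> A ** transpose A = mat 1"
  by (simp_all add: SO3_def orthogonal_matrix_def)

lemma matrix_eq3: "(A::real^3^3) = B \<longleftrightarrow> A$1$1 = B$1$1 \<and> A$1$2 = B$1$2 \<and> A$1$3 = B$1$3
   \<and> A$2$1 = B$2$1 \<and> A$2$2 = B$2$2 \<and> A$2$3 = B$2$3 \<and> A$3$1 = B$3$1 \<and> A$3$2 = B$3$2 \<and> A$3$3 = B$3$3"
  by (auto simp: vec_eq_iff forall_3)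

text \<open>A rotation equals its cofactor matrix, because it preserves the cross product and hence
each of its columns is the cross product of the other two.\<close>
lemma SO3_cofactors:
  assumes "X \<in> SO3"
  shows "X$1$1 = X$2$2 * X$3$3 - X$2$3 * X$3$2"
    "X$1$2 = X$2$3 * X$3$1 - X$2$1 * X$3$3"
    "X$1$3 = X$2$1 * X$3$2 - X$2$2 * X$3$1"
    "X$2$1 = X$1$3 * X$3$2 - X$1$2 * X$3$3"
    "X$2$2 = X$1$1 * X$3$3 - X$1$3 * X$3$1"
    "X$2$3 = X$1$2 * X$3$1 - X$1$1 * X$3$2"
    "X$3$1 = X$1$2 * X$2$3 - X$1$3 * X$2$2"
    "X$3$2 = X$1$3 * X$2$1 - X$1$1 * X$2$3"
    "X$3$3 = X$1$1 * X$2$2 - X$1$2 * X$2$1"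
proof -
  have X: "orthogonal_matrix X" "det X = 1" using assms by (auto simp: SO3_def)
  note cr = cross_orthogonal_matrix[OF X(1), unfolded X(2)]
  have "cross3 (X *v axis 2 1) (X *v axis 3 1) = X *v axis 1 1"
       "cross3 (X *v axis 3 1) (X *v axis 1 1) = X *v axis 2 1"
       "cross3 (X *v axis 1 1) (X *v axis 2 1) = X *v axis 3 1"
    by (simp_all add: cr cross_basis)
  then show "X$1$1 = X$2$2 * X$3$3 - X$2$3 * X$3$2"
    "X$1$2 = X$2$3 * X$3$1 - X$2$1 * X$3$3"
    "X$1$3 = X$2$1 * X$3$2 - X$2$2 * X$3$1"
    "X$2$1 = X$1$3 * X$3$2 - X$1$2 * X$3$3"
    "X$2$2 = X$1$1 * X$3$3 - X$1$3 * X$3$1"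
    "X$2$3 = X$1$2 * X$3$1 - X$1$1 * X$3$2"
    "X$3$1 = X$1$2 * X$2$3 - X$1$3 * X$2$2"
    "X$3$2 = X$1$3 * X$2$1 - X$1$1 * X$2$3"
    "X$3$3 = X$1$1 * X$2$2 - X$1$2 * X$2$1"
    by (simp_all add: vec_eq_iff forall_3 cross3_def matrix_vector_mult_basis column_def algebra_simps)
qed

lemma SO3_entries:
  assumes "X \<in> SO3"
  shows "X$1$1*X$1$1 + X$2$1*X$2$1 + X$3$1*X$3$1 = 1"
    "X$1$2*X$1$2 + X$2$2*X$2$2 + X$3$2*X$3$2 = 1"
    "X$1$3*X$1$3 + X$2$3*X$2$3 + X$3$3*X$3$3 = 1"
    "X$1$1*X$1$2 + X$2$1*X$2$2 + X$3$1*X$3$2 = 0"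
    "X$1$1*X$1$3 + X$2$1*X$2$3 + X$3$1*X$3$3 = 0"
    "X$1$2*X$1$3 + X$2$2*X$2$3 + X$3$2*X$3$3 = 0"
    "X$1$1*X$1$1 + X$1$2*X$1$2 + X$1$3*X$1$3 = 1"
    "X$2$1*X$2$1 + X$2$2*X$2$2 + X$2$3*X$2$3 = 1"
    "X$3$1*X$3$1 + X$3$2*X$3$2 + X$3$3*X$3$3 = 1"
    "X$1$1*X$2$1 + X$1$2*X$2$2 + X$1$3*X$2$3 = 0"
    "X$1$1*X$3$1 + X$1$2*X$3$2 + X$1$3*X$3$3 = 0"
    "X$2$1*X$3$1 + X$2$2*X$3$2 + X$2$3*X$3$3 = 0"
  using SO3_transpose_mult[OF assms]
  by (simp_all add: matrix_eq3 transpose_def matrix_matrix_mult_def sum_3 mat_def)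

text \<open>For \<open>X = quat_rotation q\<close> with \<open>q\<close> a unit quaternion, \<open>u = 4 * (q$1)\<^sup>2\<close> and the entries of
\<open>X - transpose X\<close> are \<open>4 * q$1\<close> times the imaginary components of \<open>q\<close>, up to sign. These identities are
what is left of the parametrization when \<open>q\<close> is eliminated; they make the inverse
construction in \<open>SO3_quat_lift\<close> work.\<close>
lemma SO3_trace_identities:
  assumes "X \<in> SO3"
  defines "u \<equiv> 1 + trace X"
  shows "(X$3$2 - X$2$3)\<^sup>2 = u * (1 + X$1$1 - X$2$2 - X$3$3)"
    "(X$1$3 - X$3$1)\<^sup>2 = u * (1 - X$1$1 + X$2$2 - X$3$3)"
    "(X$2$1 - X$1$2)\<^sup>2 = u * (1 - X$1$1 - X$2$2 + X$3$3)"
    "(X$3$2 - X$2$3) * (X$1$3 - X$3$1) = u * (X$1$2 + X$2$1)"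
    "(X$3$2 - X$2$3) * (X$2$1 - X$1$2) = u * (X$1$3 + X$3$1)"
    "(X$1$3 - X$3$1) * (X$2$1 - X$1$2) = u * (X$2$3 + X$3$2)"
proof -
  have u: "u = 1 + X$1$1 + X$2$2 + X$3$3" by (simp add: u_def trace_def sum_3)
  show "(X$3$2 - X$2$3)\<^sup>2 = u * (1 + X$1$1 - X$2$2 - X$3$3)" unfolding u
    using SO3_cofactors(1)[OF assms(1)] SO3_entries(1,8,9)[OF assms(1)] by algebra
  show "(X$1$3 - X$3$1)\<^sup>2 = u * (1 - X$1$1 + X$2$2 - X$3$3)" unfolding u
    using SO3_cofactors(5)[OF assms(1)] SO3_entries(2,7,9)[OF assms(1)] by algebra
  show "(X$2$1 - X$1$2)\<^sup>2 = u * (1 - X$1$1 - X$2$2 + X$3$3)" unfolding u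
    using SO3_cofactors(9)[OF assms(1)] SO3_entries(3,7,8)[OF assms(1)] by algebra
  show "(X$3$2 - X$2$3) * (X$1$3 - X$3$1) = u * (X$1$2 + X$2$1)" unfolding u
    using SO3_cofactors(2,4)[OF assms(1)] SO3_entries(4,10)[OF assms(1)] by algebra
  show "(X$3$2 - X$2$3) * (X$2$1 - X$1$2) = u * (X$1$3 + X$3$1)" unfolding u
    using SO3_cofactors(3,7)[OF assms(1)] SO3_entries(11,5)[OF assms(1)] by algebra
  show "(X$1$3 - X$3$1) * (X$2$1 - X$1$2) = u * (X$2$3 + X$3$2)" unfolding u
    using SO3_cofactors(6,8)[OF assms(1)] SO3_entries(6,12)[OF assms(1)] by algebra
qed

text \<open>Of the two unit quaternions over a rotation by an angle less than \<open>pi\<close>, this is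
the one with positive real part.\<close>
lemma SO3_quat_lift:
  assumes "X \<in> SO3" and "trace X > -1"
  obtains q where "q \<bullet> q = 1" "X = quat_rotation q" "q$1 = sqrt (1 + trace X) / 2"
proof -
  define u where "u = 1 + trace X"
  define v where "v = sqrt u"
  have v: "v > 0" "v^2 = u" "u > 0" using assms(2) by (auto simp: u_def v_def)
  have u: "u = 1 + X$1$1 + X$2$2 + X$3$3" by (simp add: u_def trace_def sum_3)
  note id = SO3_trace_identities[OF assms(1), folded u_def]
  define q :: "real^4" where "q = vector [v / 2, (X$3$2 - X$2$3) / (2 * v),
      (X$1$3 - X$3$1) / (2 * v), (X$2$1 - X$1$2) / (2 * v)]"
  have q: "q$1 = v / 2" "q$2 = (X$3$2 - X$2$3) / (2 * v)"
      "q$3 = (X$1$3 - X$3$1) / (2 * v)" "q$4 = (X$2$1 - X$1$2) / (2 * v)"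
    by (simp_all add: q_def vector_def)
  have sq: "(q$1)\<^sup>2 = u / 4" "(q$2)\<^sup>2 = (1 + X$1$1 - X$2$2 - X$3$3) / 4"
     "(q$3)\<^sup>2 = (1 - X$1$1 + X$2$2 - X$3$3) / 4" "(q$4)\<^sup>2 = (1 - X$1$1 - X$2$2 + X$3$3) / 4"
    using id v by (simp_all add: q power_divide power_mult_distrib)
  have pr: "q$2 * q$3 = (X$1$2 + X$2$1) / 4" "q$2 * q$4 = (X$1$3 + X$3$1) / 4"
     "q$3 * q$4 = (X$2$3 + X$3$2) / 4" "q$1 * q$2 = (X$3$2 - X$2$3) / 4"
     "q$1 * q$3 = (X$1$3 - X$3$1) / 4" "q$1 * q$4 = (X$2$1 - X$1$2) / 4"
    using id v by (simp_all add: q flip: power2_eq_square)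
  show thesis
  proof
    show "q \<bullet> q = 1"
      using sq by (simp add: inner_vec_def sum_4 u flip: power2_eq_square)
    show "X = quat_rotation q"
      unfolding quat_rotation_def matrix_eq3 sq pr u by (simp add: field_simps)
    show "q$1 = sqrt (1 + trace X) / 2" by (simp add: q v_def u_def)
  qed
qed

lemma SO3_trace_bounds:
  assumes "X \<in> SO3"
  shows "trace X \<le> 3" "trace X \<ge> -1"
proof -
  have "(X$1$1)\<^sup>2 \<le> 1" "(X$2$2)\<^sup>2 \<le> 1" "(X$3$3)\<^sup>2 \<le> 1"
    using SO3_entries(7-9)[OF assms] unfolding power2_eq_square
    by (smt (verit) zero_le_square)+
  then have "X$1$1 \<le> 1" "X$2$2 \<le> 1" "X$3$3 \<le> 1"
    by (auto simp: abs_square_le_1 abs_le_iff)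
  then show 1: "trace X \<le> 3" by (simp add: trace_def sum_3)
  have "0 \<le> (1 + trace X) * (3 - trace X)"
    using SO3_trace_identities(1-3)[OF assms]
    by (simp add: trace_def sum_3 algebra_simps) (smt (verit) zero_le_power2)
  then show "trace X \<ge> -1" using 1
    by (smt (verit) mult_neg_pos)
qed

lemma trace_mat3: "trace (X::real^3^3) = X$1$1 + X$2$2 + X$3$3"
  by (simp add: trace_def sum_3)

text \<open>The conjugate quaternion.\<close>
definition quat_conj :: "real^4 \<Rightarrow> real^4" where
  "quat_conj q = vector [q$1, - q$2, - q$3, - q$4]"

lemma quat_conj_nth: "quat_conj q $ 1 = q$1" "quat_conj q $ 2 = - q$2"
  "quat_conj q $ 3 = - q$3" "quat_conj q $ 4 = - q$4"
  by (simp_all add: quat_conj_def vector_def)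

lemma inner4: "(p::real^4) \<bullet> q = p$1 * q$1 + (p$2 * q$2 + p$3 * q$3 + p$4 * q$4)"
  by (simp add: inner_vec_def sum_4)

lemma transpose_quat_rotation: "transpose (quat_rotation q) = quat_rotation (quat_conj q)"
  by (simp add: matrix_eq3 transpose_def quat_rotation_def quat_conj_nth)

section \<open>The distance and the closed disk\<close>

lemma closed_SO3: "closed SO3"
proof -
  have "continuous_on UNIV (\<lambda>X::real^3^3. transpose X ** X)"
    unfolding transpose_def matrix_matrix_mult_def
    by (intro continuous_intros)
  moreover have "continuous_on UNIV (\<lambda>X::real^3^3. det X)"
    unfolding det_3 by (intro continuous_intros)
  ultimately have "closed ({X::real^3^3. transpose X ** X = mat 1} \<inter> {X. det X = 1})"
    by (intro closed_Int closed_Collect_eq) auto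
  moreover have "SO3 = {X::real^3^3. transpose X ** X = mat 1} \<inter> {X. det X = 1}"
    by (auto simp: SO3_def orthogonal_matrix)
  ultimately show ?thesis by simp
qed

lemma SO3_inner_self: "X \<in> SO3 \<Longrightarrow> X \<bullet> X = 3"
  by (simp add: SO3_transpose_mult trace_mat3 mat_def flip: trace_transpose_mult)

lemma SO3_inner_bounds:
  assumes "X \<in> SO3" "Y \<in> SO3"
  shows "X \<bullet> Y \<le> 3" "-1 \<le> X \<bullet> Y"
  using SO3_trace_bounds[OF SO3_mult[OF SO3_transpose[OF assms(1)] assms(2)]]
  by (simp_all add: trace_transpose_mult)

lemma so3_dist_inner: "so3_dist X Y = arccos ((X \<bullet> Y - 1) / 2)"
  by (simp add: so3_dist_def trace_transpose_mult)

lemma so3_dist_range: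
  assumes "X \<in> SO3" "Y \<in> SO3"
  shows "0 \<le> so3_dist X Y" "so3_dist X Y \<le> pi" "cos (so3_dist X Y) = (X \<bullet> Y - 1) / 2"
  using SO3_inner_bounds[OF assms] unfolding so3_dist_inner
  by (auto intro!: arccos_lbound arccos_ubound cos_arccos)

lemma mat1_in_SO3: "mat 1 \<in> SO3"
  by (simp add: SO3_def orthogonal_matrix_id)

lemma closure_so3_disk:
  assumes "r < pi" "X \<in> closure (so3_disk r)"
  shows "X \<in> SO3" "1 + 2 * cos r \<le> trace X"
proof -
  have "so3_disk r \<subseteq> SO3 \<inter> {X. 1 + 2 * cos r \<le> trace X}"
  proof
    fix Y assume "Y \<in> so3_disk r"
    then have Y: "Y \<in> SO3" "so3_dist (mat 1) Y < r" by (auto simp: so3_disk_def)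
    note d = so3_dist_range[OF mat1_in_SO3 Y(1)]
    have "cos r \<le> cos (so3_dist (mat 1) Y)"
      using Y(2) d assms(1) by (intro cos_monotone_0_pi_le) auto
    also have "cos (so3_dist (mat 1) Y) = (trace Y - 1) / 2"
      unfolding d(3) by (simp flip: trace_transpose_mult)
    finally show "Y \<in> SO3 \<inter> {X. 1 + 2 * cos r \<le> trace X}" using Y by simp
  qed
  moreover have "closed (SO3 \<inter> {X. 1 + 2 * cos r \<le> trace X})"
    unfolding trace_mat3 by (intro closed_Int closed_SO3 closed_Collect_le continuous_intros)
  ultimately have "closure (so3_disk r) \<subseteq> SO3 \<inter> {X. 1 + 2 * cos r \<le> trace X}"
    by (rule closure_minimal)
  with assms(2) show "X \<in> SO3" "1 + 2 * cos r \<le> trace X" by auto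
qed

section \<open>Comparison of distances in small triangles\<close>

text \<open>By the inequality of arithmetic and geometric means, since the imaginary parts have squared
norm at most \<open>1 - c\<close>.\<close>
lemma quat_vector_part_bound:
  fixes p q :: "real^4"
  assumes "p \<bullet> p = 1" "q \<bullet> q = 1" "c \<le> (p$1)\<^sup>2" "c \<le> (q$1)\<^sup>2"
  shows "c - 1 \<le> p$2 * q$2 + p$3 * q$3 + p$4 * q$4"
proof -
  have "0 \<le> (p$2 + q$2)\<^sup>2 + (p$3 + q$3)\<^sup>2 + (p$4 + q$4)\<^sup>2" by simp
  then show ?thesis using assms unfolding inner4 by (simp add: power2_eq_square algebra_simps)
qed

text \<open>The triangle inequality through the identity, for points at distance at most \<open>r\<close> from it:
their distance is at most \<open>2 * r\<close>. In terms of the lifts with positive real part,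
\<open>p \<bullet> q \<ge> (cos (r/2))\<^sup>2 - (sin (r/2))\<^sup>2\<close>.\<close>
lemma SO3_inner_ge:
  assumes "X \<in> SO3" "Y \<in> SO3" "0 \<le> r" "r < pi / 2"
    and "1 + 2 * cos r \<le> trace X" "1 + 2 * cos r \<le> trace Y"
  shows "1 + 2 * cos (2 * r) \<le> X \<bullet> Y"
proof -
  define c where "c = (cos (r / 2))\<^sup>2"
  have c: "cos r = 2 * c - 1" using cos_double_cos[of "r / 2"] by (simp add: c_def)
  have cr: "cos r > 0" using assms by (intro cos_gt_zero_pi) auto
  then have t: "trace X > -1" "trace Y > -1" using assms by auto
  obtain p where p: "p \<bullet> p = 1" "X = quat_rotation p" "p$1 = sqrt (1 + trace X) / 2"
    using SO3_quat_lift[OF assms(1) t(1)] .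
  obtain q where q: "q \<bullet> q = 1" "Y = quat_rotation q" "q$1 = sqrt (1 + trace Y) / 2"
    using SO3_quat_lift[OF assms(2) t(2)] .
  have sq: "c \<le> (p$1)\<^sup>2" "c \<le> (q$1)\<^sup>2"
    using assms(5,6) t by (simp_all add: p(3) q(3) power_divide c)
  have "sqrt c * sqrt c \<le> p$1 * q$1"
    using sq t by (intro mult_mono real_le_lsqrt) (auto simp: p(3) q(3) c_def)
  then have "c \<le> p$1 * q$1" by (simp add: c_def power2_eq_square)
  then have "cos r \<le> p \<bullet> q"
    using quat_vector_part_bound[OF p(1) q(1) sq] unfolding inner4 c by simp
  then have "(cos r)\<^sup>2 \<le> (p \<bullet> q)\<^sup>2" using cr by (intro power_mono) auto
  then show ?thesis using p q by (simp add: inner_quat_rotation cos_double_cos)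
qed

text \<open>The key inequality. Let \<open>A = transpose X ** Y\<close> and \<open>B = transpose X ** Z\<close> for rotations \<open>Y\<close> and \<open>Z\<close> at
distance at most \<open>pi/2\<close> from the rotation \<open>X\<close>. If \<open>Z\<close> is no farther from \<open>Y\<close> than from \<open>X\<close>,
then the directions at \<open>X\<close> towards \<open>Y\<close> and \<open>Z\<close> make an angle of at most \<open>pi/2\<close>. With lifts
\<open>p\<close> and \<open>q\<close>, the difference of the two sides is \<open>16 * p$1 * q$1 * v\<close>, where \<open>v\<close> is the inner
product of the imaginary parts.\<close>
lemma SO3_trace_compare:
  assumes "A \<in> SO3" "B \<in> SO3" "1 \<le> trace A" "1 \<le> trace B" "trace B \<le> A \<bullet> B"
  shows "trace (A ** B) \<le> A \<bullet> B"
proof -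
  have t: "trace A > -1" "trace B > -1" using assms by auto
  obtain p where p: "p \<bullet> p = 1" "A = quat_rotation p" "p$1 = sqrt (1 + trace A) / 2"
    using SO3_quat_lift[OF assms(1) t(1)] .
  obtain q where q: "q \<bullet> q = 1" "B = quat_rotation q" "q$1 = sqrt (1 + trace B) / 2"
    using SO3_quat_lift[OF assms(2) t(2)] .
  define v where "v = p$2 * q$2 + p$3 * q$3 + p$4 * q$4"
  have AB: "A \<bullet> B = 4 * (p$1 * q$1 + v)\<^sup>2 - 1"
    using p q by (simp add: inner_quat_rotation inner4[of p q] v_def)
  have "trace (A ** B) = transpose A \<bullet> B"
    using trace_transpose_mult[of "transpose A" B] by simp
  also have "\<dots> = 4 * (p$1 * q$1 - v)\<^sup>2 - 1"
  proof -
    have "quat_conj p \<bullet> quat_conj p = 1" using p(1) by (simp add: inner4 quat_conj_nth)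
    then show ?thesis
      unfolding p(2) q(2) transpose_quat_rotation inner_quat_rotation
      by (simp add: q(1) inner4[of "quat_conj p" q] quat_conj_nth v_def algebra_simps)
  qed
  finally have ABt: "trace (A ** B) = 4 * (p$1 * q$1 - v)\<^sup>2 - 1" .
  have sq: "1/2 \<le> (p$1)\<^sup>2" "1/2 \<le> (q$1)\<^sup>2"
    using assms(3,4) t by (simp_all add: p(3) q(3) power_divide)
  have pos: "p$1 > 0" "q$1 > 0" using t by (simp_all add: p(3) q(3))
  have p1: "p$1 \<le> 1"
    using SO3_trace_bounds[OF assms(1)] real_le_lsqrt[of 2 "1 + trace A"] unfolding p(3) by simp
  \<comment> \<open>The lower bounds on the real parts fix the sign of \<open>p$1 * q$1 + v\<close>, so that the hypothesis
    on the traces, which only controls its square, can be used.\<close>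
  have "sqrt (1/2) * sqrt (1/2) \<le> p$1 * q$1"
    using sq pos by (intro mult_mono real_le_lsqrt) auto
  then have "1/2 \<le> p$1 * q$1" by simp
  with quat_vector_part_bound[OF p(1) q(1) sq, folded v_def]
  have z: "0 \<le> p$1 * q$1 + v" by simp
  have "(q$1)\<^sup>2 \<le> (p$1 * q$1 + v)\<^sup>2"
    using assms(5) t AB by (simp add: q(3) power_divide)
  then have "q$1 \<le> p$1 * q$1 + v" using z by (rule power2_le_imp_le)
  moreover have "p$1 * q$1 \<le> q$1" using p1 pos by simp
  ultimately have "v \<ge> 0" by simp
  then have "0 \<le> 16 * (p$1 * q$1) * v" using pos by simp
  then show ?thesis unfolding AB ABt by (simp add: power2_eq_square algebra_simps)
qed

lemma SO3_trace_square:
  assumes "A \<in> SO3"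
  shows "3 - trace (A ** A) = (3 - trace A) * (1 + trace A)"
proof -
  have "trace (A ** A) = (A$1$1)\<^sup>2 + (A$2$2)\<^sup>2 + (A$3$3)\<^sup>2
      + 2 * (A$1$2 * A$2$1 + A$1$3 * A$3$1 + A$2$3 * A$3$2)"
    by (simp add: trace_mat3 matrix_matrix_mult_def sum_3 power2_eq_square)
  then show ?thesis
    unfolding trace_mat3 using SO3_cofactors(1,5,9)[OF assms] by algebra
qed

section \<open>Growth of the minimum of a finite family\<close>

text \<open>A comparison principle for the minimum of a finite family, which need not be
differentiable: only a member that attains the minimum has to have derivative above \<open>\<kappa>\<close>, and only
while it is at most \<open>L\<close>.\<close>
lemma family_min_growth:
  fixes u :: "'i \<Rightarrow> real \<Rightarrow> real"
  assumes "finite P"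
    and cont: "\<And>p. p \<in> P \<Longrightarrow> continuous_on {0..} (u p)"
    and init: "\<And>p. p \<in> P \<Longrightarrow> a \<le> u p 0"
    and deriv: "\<And>p t. p \<in> P \<Longrightarrow> 0 < t \<Longrightarrow> \<forall>q\<in>P. u p t \<le> u q t \<Longrightarrow> u p t \<le> L \<Longrightarrow>
      \<exists>d>\<kappa>. (u p has_real_derivative d) (at t)"
    and "0 \<le> \<kappa>" "0 \<le> \<tau>" "q \<in> P"
  shows "min (a + \<kappa> * \<tau>) L \<le> u q \<tau>"
proof -
  \<comment> \<open>Minimize \<open>u p s - \<kappa> * s\<close> over all members and all times up to \<open>\<tau>\<close>. A minimum at a positive
    time with value \<open>u p s \<le> L\<close> would have a positive derivative there.\<close>
  define f where "f p s = u p s - \<kappa> * s" for p s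
  have "\<exists>s\<in>{0..\<tau>}. \<forall>x\<in>{0..\<tau>}. f p s \<le> f p x" if "p \<in> P" for p
    unfolding f_def using \<open>0 \<le> \<tau>\<close>
    by (intro continuous_attains_inf continuous_intros continuous_on_subset[OF cont[OF that]]) auto
  then obtain s where s: "\<And>p. p \<in> P \<Longrightarrow> s p \<in> {0..\<tau>}"
      "\<And>p x. p \<in> P \<Longrightarrow> x \<in> {0..\<tau>} \<Longrightarrow> f p (s p) \<le> f p x"
    by metis
  obtain p where p: "p \<in> P" "\<And>q. q \<in> P \<Longrightarrow> f p (s p) \<le> f q (s q)"
    using ex_is_arg_min_if_finite[OF \<open>finite P\<close>, of "\<lambda>p. f p (s p)"] \<open>q \<in> P\<close>
    by (auto simp: is_arg_min_linorder)
  define t where "t = s p"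
  have t: "0 \<le> t" "t \<le> \<tau>" using s(1)[OF p(1)] by (auto simp: t_def)
  have least: "f p t \<le> f q x" if "q \<in> P" "x \<in> {0..\<tau>}" for q x
    using p(2)[OF that(1)] s(2)[OF that] by (simp add: t_def)
  have q: "f p t \<le> f q \<tau>" using \<open>q \<in> P\<close> \<open>0 \<le> \<tau>\<close> by (intro least) auto
  show ?thesis
  proof (cases "t = 0")
    case True
    then show ?thesis using q init[OF p(1)] by (simp add: f_def)
  next
    case False
    then have "t > 0" using t by simp
    have "L < u p t"
    proof (rule ccontr)
      assume "\<not> L < u p t"
      moreover have "\<forall>q\<in>P. u p t \<le> u q t" using least[of _ t] t by (simp add: f_def)
      ultimately obtain d where d: "d > \<kappa>" "(u p has_real_derivative d) (at t)"
        using deriv[OF p(1) \<open>t > 0\<close>] by auto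
      have "(f p has_real_derivative d - \<kappa>) (at t)"
        unfolding f_def by (auto intro!: derivative_eq_intros d(2))
      from DERIV_pos_inc_left[OF this] obtain e where e: "e > 0" "\<And>h. 0 < h \<Longrightarrow> h < e \<Longrightarrow> f p (t - h) < f p t"
        using d(1) by auto
      define h where "h = min t (e / 2)"
      have h: "0 < h" "h < e" "h \<le> t" using \<open>t > 0\<close> \<open>e > 0\<close> by (auto simp: h_def)
      with least[OF p(1), of "t - h"] e(2)[of h] t show False by simp
    qed
    moreover have "\<kappa> * t \<le> \<kappa> * \<tau>" using t \<open>0 \<le> \<kappa>\<close> by (intro mult_left_mono)
    ultimately show ?thesis using q by (simp add: f_def)
  qed
qed

section \<open>The gradient of the interaction kernel\<close>

text \<open>The function \<open>\<theta> / sin \<theta>\<close>, extended by its limit at \<open>0\<close>. It appears in the logarithm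
\<open>log M = (\<theta> / (2 * sin \<theta>)) (M - transpose M)\<close> of a rotation \<open>M\<close> by the angle \<open>\<theta> < pi\<close>.\<close>
definition angle_sin_ratio :: "real \<Rightarrow> real" where
  "angle_sin_ratio \<theta> = (if \<theta> = 0 then 1 else \<theta> / sin \<theta>)"

text \<open>At \<open>s = 1\<close> the derivative is one-sided and \<open>arccos\<close> itself has none. This is the case of
coinciding rotations.\<close>
lemma arccos_squared_derivative:
  assumes "-1 < s" "s \<le> 1"
  shows "((\<lambda>x. (arccos x)\<^sup>2) has_real_derivative - (2 * angle_sin_ratio (arccos s))) (at s within {-1..1})"
proof (cases "s = 1")
  case False
  then have "s < 1" using assms by simp
  have "0 < arccos s" using arccos_lt_bounded[of s] assms \<open>s < 1\<close> by simp
  have "((\<lambda>x. (arccos x)\<^sup>2) has_real_derivative 2 * arccos s * inverse (- sqrt (1 - s\<^sup>2))) (at s)"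
    using assms \<open>s < 1\<close> by (auto intro!: derivative_eq_intros)
  moreover have "2 * arccos s * inverse (- sqrt (1 - s\<^sup>2)) = - (2 * angle_sin_ratio (arccos s))"
    unfolding angle_sin_ratio_def if_not_P[OF less_imp_neq[OF \<open>0 < arccos s\<close>, symmetric]]
      sin_arccos[OF less_imp_le[OF assms(1)] assms(2)] inverse_minus_eq divide_inverse by simp
  ultimately show ?thesis by (metis has_field_derivative_at_within)
next
  case True
  have "(arccos \<longlongrightarrow> arccos 1) (at 1 within {-1..1})"
    using continuous_on_arccos' unfolding continuous_on_def by (rule bspec) simp
  then have "(arccos \<longlongrightarrow> 0) (at_left 1)"
    by (simp add: at_within_Icc_at_left)
  moreover have ev: "\<forall>\<^sub>F x in at_left (1::real). -1 < x \<and> x < 1"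
    by (auto intro!: eventually_conj eventually_at_leftI[of "-1"])
  then have "\<forall>\<^sub>F x in at_left 1. 0 < arccos x"
    by eventually_elim (use arccos_lt_bounded in auto)
  ultimately have "filterlim arccos (at_right 0) (at_left 1)"
    by (auto simp: filterlim_at elim: eventually_mono)
  moreover have "((\<lambda>\<theta>::real. \<theta>\<^sup>2 / (cos \<theta> - 1)) \<longlongrightarrow> -2) (at_right 0)"
    by real_asymp
  ultimately have "((\<lambda>x. (arccos x)\<^sup>2 / (cos (arccos x) - 1)) \<longlongrightarrow> -2) (at_left 1)"
    by (rule filterlim_compose[rotated])
  moreover have "\<forall>\<^sub>F x in at_left 1. (arccos x)\<^sup>2 / (cos (arccos x) - 1) = ((arccos x)\<^sup>2 - (arccos 1)\<^sup>2) / (x - 1)"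
    using ev by eventually_elim (auto simp: cos_arccos)
  ultimately have "((\<lambda>x. ((arccos x)\<^sup>2 - (arccos 1)\<^sup>2) / (x - 1)) \<longlongrightarrow> -2) (at_left 1)"
    by (rule Lim_transform_eventually)
  then show ?thesis
    by (simp add: True has_field_derivative_iff angle_sin_ratio_def at_within_Icc_at_left)
qed

lemma transpose_diff3: "transpose (A - B) = transpose A - transpose (B::real^3^3)"
  by (simp add: matrix_eq3 transpose_def)

lemma skew_entries:
  fixes A :: "real^3^3"
  assumes "transpose A = - A"
  shows "A$1$1 = 0" "A$2$2 = 0" "A$3$3 = 0" "A$1$2 = - A$2$1" "A$2$3 = - A$3$2" "A$3$1 = - A$1$3"
proof -
  have s: "A$j$i = - A$i$j" for i j
    using arg_cong[OF assms, of "\<lambda>X. X$i$j"] by (simp add: transpose_def)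
  show "A$1$1 = 0" "A$2$2 = 0" "A$3$3 = 0" "A$1$2 = - A$2$1" "A$2$3 = - A$3$2" "A$3$1 = - A$1$3"
    using s[of 1 1] s[of 2 2] s[of 3 3] by simp_all (rule s)+
qed

text \<open>The curve is \<open>R ** quat_rotation (q t)\<close> up to normalization, where \<open>q t\<close> has real part \<open>1\<close> and
imaginary part \<open>t/2\<close> times the axial vector of \<open>A\<close>, for \<open>V = R ** A\<close>.\<close>
lemma SO3_tangent_curve:
  assumes "R \<in> SO3" "V \<in> so3_tangent R"
  obtains \<gamma> where "(\<gamma> has_vector_derivative V) (at 0)" "\<gamma> 0 = R" "\<And>t. \<gamma> t \<in> SO3"
proof -
  obtain A where A: "V = R ** A" "transpose A = - A" using assms(2) by (auto simp: so3_tangent_def)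
  have a: "A$1$1 = 0" "A$2$2 = 0" "A$3$3 = 0" "A$1$2 = - A$2$1" "A$2$3 = - A$3$2" "A$3$1 = - A$1$3"
    using skew_entries[OF A(2)] .
  define q :: "real \<Rightarrow> real^4" where "q t = vector [1, t * A$3$2 / 2, t * A$1$3 / 2, t * A$2$1 / 2]" for t
  define n where "n = ((A$3$2)\<^sup>2 + (A$1$3)\<^sup>2 + (A$2$1)\<^sup>2) / 4"
  define C where "C = quat_rotation (vector [0, A$3$2 / 2, A$1$3 / 2, A$2$1 / 2])"
  have q: "q t $ 1 = 1" "q t $ 2 = t * A$3$2 / 2" "q t $ 3 = t * A$1$3 / 2" "q t $ 4 = t * A$2$1 / 2" for t
    by (simp_all add: q_def vector_def)
  have qq: "q t \<bullet> q t = 1 + t\<^sup>2 * n" for t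
    by (simp add: inner4 q n_def power2_eq_square field_simps)
  have n: "n \<ge> 0" by (simp add: n_def)
  have rot: "quat_rotation (q t) = mat 1 + t *\<^sub>R A + t\<^sup>2 *\<^sub>R C" for t
    unfolding quat_rotation_def q C_def matrix_eq3
    by (simp add: vector_def mat_def a power2_eq_square field_simps)
  define \<gamma> where "\<gamma> t = (1 / (1 + t\<^sup>2 * n)) *\<^sub>R (R + t *\<^sub>R V + t\<^sup>2 *\<^sub>R (R ** C))" for t :: real
  have \<gamma>: "\<gamma> t = R ** ((1 / (q t \<bullet> q t)) *\<^sub>R quat_rotation (q t))" for t
    unfolding \<gamma>_def rot qq A(1)
    by (simp add: matrix_add_ldistrib matrix_scalar_ac scalar_matrix_assoc[symmetric] scaleR_add_right)
  show thesis
  proof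
    have "q t \<noteq> 0" for t using q(1)[of t] by auto
    then show "\<gamma> t \<in> SO3" for t
      unfolding \<gamma> by (intro SO3_mult assms SO3_quat_rotation_scaled)
    show "\<gamma> 0 = R" by (simp add: \<gamma>_def)
    show "(\<gamma> has_vector_derivative V) (at 0)"
      unfolding \<gamma>_def using n
      by (auto intro!: derivative_eq_intros)
  qed
qed

text \<open>A derivative within \<^const>\<open>SO3\<close> is not unique as a linear map, but its value on a tangent vector
is the derivative along any curve in \<^const>\<open>SO3\<close> with that velocity.\<close>
lemma has_so3_gradient_unique:
  assumes "R \<in> SO3" and G: "has_so3_gradient f G R" and H: "has_so3_gradient f H R"
  shows "G = H"
proof -
  obtain B where B: "G = R ** B" "transpose B = - B" using G by (auto simp: has_so3_gradient_def so3_tangent_def)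
  obtain C where C: "H = R ** C" "transpose C = - C" using H by (auto simp: has_so3_gradient_def so3_tangent_def)
  have tr: "transpose R ** (R ** X) = X" for X :: "real^3^3"
    by (simp add: matrix_mul_assoc SO3_transpose_mult[OF assms(1)])
  \<comment> \<open>Test both gradients against their difference.\<close>
  define V where "V = R ** (B - C)"
  have "transpose (B - C) = - (B - C)" by (simp add: transpose_diff3 B(2) C(2))
  then have V: "V \<in> so3_tangent R" by (auto simp: V_def so3_tangent_def)
  obtain \<gamma> where \<gamma>: "(\<gamma> has_vector_derivative V) (at 0)" "\<gamma> 0 = R" "\<And>t. \<gamma> t \<in> SO3"
    using SO3_tangent_curve[OF assms(1) V] by metis
  have along: "((\<lambda>t. f (\<gamma> t)) has_vector_derivative so3_metric R F V) (at 0)"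
    if F: "has_so3_gradient f F R" for F
  proof -
    obtain f' where f': "(f has_derivative f') (at R within SO3)" "f' V = so3_metric R F V"
      using F V by (auto simp: has_so3_gradient_def)
    have "(f has_derivative f') (at (\<gamma> 0) within range \<gamma>)"
      using f'(1) \<gamma>(2,3) by (auto intro: has_derivative_subset)
    from vector_derivative_diff_chain_within[OF \<gamma>(1) this]
    show ?thesis by (simp add: f'(2) o_def)
  qed
  have "so3_metric R G V = so3_metric R H V"
    using vector_derivative_unique_at[OF along[OF G] along[OF H]] .
  then have "(B - C) \<bullet> (B - C) = 0"
    by (simp add: so3_metric_def B(1) C(1) V_def tr inner_diff_left)
  then show ?thesis by (simp add: B(1) C(1))
qed

text \<open>The formula \<open>- 2 g'(d\<^sup>2) log\<^sub>R Q\<close> for the gradient of \<open>g(d\<^sup>2)\<close>, with the logarithm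
written out; the factor \<open>2\<close> cancels against the \<open>1/2\<close> in the logarithm.\<close>
lemma so3_gradient_kernel:
  assumes K: "\<And>X. X \<in> SO3 \<Longrightarrow> k X = g ((so3_dist X Q)\<^sup>2)"
    and g: "\<And>s. s \<ge> 0 \<Longrightarrow> (g has_real_derivative g' s) (at s within {0..})"
    and R: "R \<in> SO3" and Q: "Q \<in> SO3" and lt: "so3_dist R Q < pi"
  defines "\<theta> \<equiv> so3_dist R Q" and "M \<equiv> transpose R ** Q"
  shows "so3_gradient k R = - (g' (\<theta>\<^sup>2) * angle_sin_ratio \<theta>) *\<^sub>R (R ** (M - transpose M))"
proof -
  define w where "w = g' (\<theta>\<^sup>2) * angle_sin_ratio \<theta>"
  define s where "s X = (X \<bullet> Q - 1) / 2" for X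
  have s_range: "s ` SO3 \<subseteq> {-1..1}" using SO3_inner_bounds[OF _ Q] by (force simp: s_def)
  have dist: "so3_dist X Q = arccos (s X)" for X by (simp add: so3_dist_inner s_def)
  have \<theta>: "\<theta> = arccos (s R)" by (simp add: \<theta>_def dist)
  have sR: "-1 < s R" "s R \<le> 1"
  proof -
    have "cos pi < cos (so3_dist R Q)"
      using lt so3_dist_range[OF R Q] by (intro cos_monotone_0_pi) auto
    then show "-1 < s R" using so3_dist_range(3)[OF R Q] by (simp add: s_def)
    show "s R \<le> 1" using s_range R by auto
  qed
  have "((\<lambda>x. g ((arccos x)\<^sup>2)) has_real_derivative g' (\<theta>\<^sup>2) * - (2 * angle_sin_ratio \<theta>))
      (at (s R) within {-1..1})"
  proof -
    have "(g has_real_derivative g' (\<theta>\<^sup>2)) (at ((arccos (s R))\<^sup>2) within (\<lambda>x. (arccos x)\<^sup>2) ` {-1..1})"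
      unfolding \<theta> by (rule DERIV_subset[OF g]) auto
    from DERIV_image_chain[OF this arccos_squared_derivative[OF sR]]
    show ?thesis by (simp add: o_def \<theta>)
  qed
  then have d: "((\<lambda>x. g ((arccos x)\<^sup>2)) has_derivative (\<lambda>h. - 2 * w * h)) (at (s R) within s ` SO3)"
    unfolding has_field_derivative_def
    by (intro has_derivative_subset[OF _ s_range], elim has_derivative_eq_rhs) (auto simp: w_def)
  have "(s has_derivative (\<lambda>V. (V \<bullet> Q) / 2)) (at R within SO3)"
    unfolding s_def by (auto intro!: derivative_eq_intros)
  from has_derivative_in_compose[OF this d]
  have "((\<lambda>X. g ((arccos (s X))\<^sup>2)) has_derivative (\<lambda>V. - w * (V \<bullet> Q))) (at R within SO3)"
    by simp
  then have der: "(k has_derivative (\<lambda>V. - w * (V \<bullet> Q))) (at R within SO3)"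
    by (rule has_derivative_transform[OF R, rotated]) (simp add: K dist)
  define B where "B = - w *\<^sub>R (M - transpose M)"
  have B: "transpose B = - B" by (simp add: B_def matrix_eq3 transpose_def algebra_simps)
  have "has_so3_gradient k (R ** B) R"
    unfolding has_so3_gradient_def
  proof (intro conjI exI[of _ "\<lambda>V. - w * (V \<bullet> Q)"] der ballI)
    show "R ** B \<in> so3_tangent R" using B by (auto simp: so3_tangent_def)
    fix V assume "V \<in> so3_tangent R"
    then obtain A where A: "V = R ** A" "transpose A = - A" by (auto simp: so3_tangent_def)
    have a: "A$1$1 = 0" "A$2$2 = 0" "A$3$3 = 0" "A$1$2 = - A$2$1" "A$2$3 = - A$3$2" "A$3$1 = - A$1$3"
      using skew_entries[OF A(2)] .
    have tr: "transpose R ** (R ** X) = X" for X :: "real^3^3"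
      by (simp add: matrix_mul_assoc SO3_transpose_mult[OF R])
    have "V \<bullet> Q = A \<bullet> M"
      by (simp add: A(1) M_def matrix_transpose_mul matrix_mul_assoc flip: trace_transpose_mult)
    then have "- w * (V \<bullet> Q) = - w * (A \<bullet> M)" by simp
    also have "\<dots> = (1 / 2) * (B \<bullet> A)"
      by (simp add: B_def inner_mat3 sum_3 a transpose_def algebra_simps)
    also have "\<dots> = so3_metric R (R ** B) V" by (simp add: so3_metric_def A(1) tr)
    finally show "- w * (V \<bullet> Q) = so3_metric R (R ** B) V" .
  qed
  then have "so3_gradient k R = R ** B"
    unfolding so3_gradient_def using has_so3_gradient_unique[OF R] by blast
  also have "\<dots> = - w *\<^sub>R (R ** (M - transpose M))"
    by (simp only: B_def matrix_scalar_ac scalar_matrix_assoc[symmetric])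
  finally show ?thesis by (simp add: w_def)
qed

section \<open>Contraction of the diameter\<close>

text \<open>The direction of \<open>log\<^sub>X Y\<close> at \<open>X\<close>, as a tangent vector that is not normalized:
\<open>log\<^sub>X Y = (\<theta> / (2 * sin \<theta>)) * so3_pull X Y\<close> with \<open>\<theta>\<close> the distance, if \<open>0 < \<theta> < pi\<close>.\<close>
definition so3_pull :: "real^3^3 \<Rightarrow> real^3^3 \<Rightarrow> real^3^3" where
  "so3_pull X Y = X ** (transpose X ** Y - transpose (transpose X ** Y))"

lemma inner_matrix_mult_left: "((A::real^3^3) ** (B::real^3^3)) \<bullet> C = B \<bullet> (transpose A ** C)"
  by (simp only: trace_transpose_mult[symmetric] matrix_transpose_mul matrix_mul_assoc)

lemma SO3_inner_transpose_mult:
  fixes Y Z :: "real^3^3"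
  shows "X \<in> SO3 \<Longrightarrow> (transpose X ** Y) \<bullet> (transpose X ** Z) = Y \<bullet> Z"
  by (simp add: inner_matrix_mult_left matrix_mul_assoc SO3_transpose_mult)

lemma inner_so3_pull:
  assumes "X \<in> SO3"
  shows "so3_pull X Y \<bullet> Z = Y \<bullet> Z - trace ((transpose X ** Y) ** (transpose X ** Z))"
proof -
  have "transpose (transpose X ** Y) \<bullet> (transpose X ** Z) = trace ((transpose X ** Y) ** (transpose X ** Z))"
    using trace_transpose_mult[of "transpose (transpose X ** Y)"] by simp
  then show ?thesis
    by (simp only: so3_pull_def inner_matrix_mult_left[of X] inner_diff_left SO3_inner_transpose_mult[OF assms])
qed

text \<open>To first order, moving \<open>X\<close> towards \<open>Y\<close> does not increase its distance from \<open>Z\<close>, provided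
that \<open>Y\<close> is at least as close to \<open>Z\<close> as \<open>X\<close> is, and that \<open>Y\<close> and \<open>Z\<close> are within \<open>pi/2\<close> of \<open>X\<close>.\<close>
lemma inner_so3_pull_nonneg:
  assumes "X \<in> SO3" "Y \<in> SO3" "Z \<in> SO3" "1 \<le> X \<bullet> Y" "1 \<le> X \<bullet> Z" "X \<bullet> Z \<le> Y \<bullet> Z"
  shows "0 \<le> so3_pull X Y \<bullet> Z"
  using SO3_trace_compare[of "transpose X ** Y" "transpose X ** Z"] assms
  by (simp add: inner_so3_pull SO3_inner_transpose_mult SO3_mult SO3_transpose trace_transpose_mult)

lemma inner_so3_pull_same:
  assumes "X \<in> SO3" "Y \<in> SO3"
  shows "so3_pull X Y \<bullet> Y = (3 - X \<bullet> Y) * (1 + X \<bullet> Y)"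
  using SO3_trace_square[OF SO3_mult[OF SO3_transpose[OF assms(1)] assms(2)]]
  by (simp add: inner_so3_pull assms SO3_inner_self trace_transpose_mult)

lemma real_power_mono: "0 < s \<Longrightarrow> s \<le> t \<Longrightarrow> 0 \<le> a \<Longrightarrow> real_power s a \<le> real_power t a"
  by (simp add: real_power_def powr_mono2)

lemma real_power_pos: "0 < s \<Longrightarrow> 0 < real_power s a"
  by (simp add: real_power_def)

lemma real_power_nonneg: "0 \<le> real_power s a"
  by (simp add: real_power_def)

text \<open>The pull of \<open>Y\<close> on \<open>X\<close> makes \<open>X \<bullet> Y\<close> grow at a rate bounded below, as long as
\<open>X \<bullet> Y \<le> L\<close>, that is, while the distance is at least \<open>\<delta>\<close>. Since \<open>X \<bullet> Y = 1 + 2 * cos \<theta>\<close>, the right-hand side is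
\<open>4 * g' (\<theta>\<^sup>2) * \<theta> * sin \<theta>\<close>, and \<open>\<theta> * sin \<theta>\<close> is increasing up to \<open>pi/2\<close>.\<close>
lemma weighted_pull_lower_bound:
  fixes X Y :: "real^3^3"
  assumes "X \<in> SO3" "Y \<in> SO3" and r: "r < pi / 4" and le: "so3_dist X Y \<le> 2 * r"
    and g': "\<And>s. s \<in> {0..4 * r\<^sup>2} \<Longrightarrow> g' s \<ge> c * real_power s \<alpha>" and "c > 0" "\<alpha> \<ge> 0"
    and L: "1 \<le> L" "L < 3" "X \<bullet> Y \<le> L"
  defines "\<delta> \<equiv> arccos ((L - 1) / 2)" and "\<theta> \<equiv> so3_dist X Y"
  shows "4 * c * real_power (\<delta>\<^sup>2) \<alpha> * \<delta> * sin \<delta>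
      \<le> g' (\<theta>\<^sup>2) * angle_sin_ratio \<theta> * ((3 - X \<bullet> Y) * (1 + X \<bullet> Y))"
proof -
  note d = so3_dist_range[OF assms(1,2), folded \<theta>_def]
  have "\<theta> = arccos ((X \<bullet> Y - 1) / 2)" by (simp add: \<theta>_def so3_dist_inner)
  then have \<delta>: "0 < \<delta>" "\<delta> \<le> \<theta>"
    using L SO3_inner_bounds[OF assms(1,2)] arccos_lt_bounded[of "(L - 1) / 2"]
    by (auto simp: \<delta>_def intro!: arccos_le_arccos)
  have \<theta>: "0 < \<theta>" "\<theta> < pi / 2" using \<delta> le r by (auto simp: \<theta>_def)
  have sin: "0 < sin \<delta>" "sin \<delta> \<le> sin \<theta>" "0 < sin \<theta>"
    using \<delta> \<theta> by (auto intro!: sin_gt_zero sin_monotone_2pi_le)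
  have "\<theta>\<^sup>2 \<le> (2 * r)\<^sup>2" using \<theta> le by (intro power_mono) (auto simp: \<theta>_def)
  then have "c * real_power (\<theta>\<^sup>2) \<alpha> \<le> g' (\<theta>\<^sup>2)" by (intro g') (auto simp: power_mult_distrib)
  moreover have "real_power (\<delta>\<^sup>2) \<alpha> \<le> real_power (\<theta>\<^sup>2) \<alpha>"
    using \<delta> \<open>\<alpha> \<ge> 0\<close> by (intro real_power_mono power_mono) auto
  ultimately have "c * real_power (\<delta>\<^sup>2) \<alpha> \<le> g' (\<theta>\<^sup>2)"
    using \<open>c > 0\<close> by (meson mult_left_mono less_imp_le order_trans)
  moreover have "\<delta> * sin \<delta> \<le> \<theta> * sin \<theta>"
    using \<delta> sin by (intro mult_mono) auto
  ultimately have "(c * real_power (\<delta>\<^sup>2) \<alpha>) * (\<delta> * sin \<delta>) \<le> g' (\<theta>\<^sup>2) * (\<theta> * sin \<theta>)"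
    using \<delta> sin \<open>c > 0\<close> real_power_nonneg[of "\<delta>\<^sup>2" \<alpha>]
    by (intro mult_mono) (auto intro: order_trans[rotated])
  moreover have "angle_sin_ratio \<theta> * ((3 - X \<bullet> Y) * (1 + X \<bullet> Y)) = 4 * (\<theta> * sin \<theta>)"
  proof -
    have XY: "X \<bullet> Y = 1 + 2 * cos \<theta>" using d(3) by simp
    have "(3 - X \<bullet> Y) * (1 + X \<bullet> Y) = 4 * (sin \<theta>)\<^sup>2"
      unfolding XY sin_squared_eq by (simp add: power2_eq_square algebra_simps)
    then show ?thesis
      using \<theta> sin by (simp add: angle_sin_ratio_def power2_eq_square)
  qed
  ultimately show ?thesis by (simp add: mult.assoc)
qed

theorem theorem5p12:
  fixes K :: "real^3^3 \<Rightarrow> real^3^3 \<Rightarrow> real"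
    and g g' :: "real \<Rightarrow> real"
    and r c \<alpha> :: real
    and N :: nat
    and R0 :: "nat \<Rightarrow> real^3^3"
    and R :: "nat \<Rightarrow> real \<Rightarrow> real^3^3"
  assumes "\<And>P Q. P \<in> SO3 \<Longrightarrow> Q \<in> SO3 \<Longrightarrow> K P Q = g ((so3_dist P Q)\<^sup>2)"
    and "\<And>s. s \<ge> 0 \<Longrightarrow> (g has_real_derivative g' s) (at s within {0..})"
    and "locally_lipschitz_on {0..} g'"
    and "0 < r" and "r < pi / 4"
    and "N > 0"
    and "continuously_differentiable_on {0..4 * r\<^sup>2} g'"
    and "c > 0" and "\<alpha> \<ge> 0"
    and "\<And>s. s \<in> {0..4 * r\<^sup>2} \<Longrightarrow> g' s \<ge> c * real_power s \<alpha>"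
    and "\<And>i. i \<in> {1..N} \<Longrightarrow> R0 i \<in> closure (so3_disk r)"
    and "global_solution K r N R0 R"
  shows "\<forall>i\<in>{1..N}. \<forall>j\<in>{1..N}. ((\<lambda>t. so3_dist (R i t) (R j t)) \<longlongrightarrow> 0) at_top"
proof -
  note K = assms(1) and g = assms(2) and r = assms(4,5) and N = assms(6)
    and g' = assms(10)
  define I where "I = {1..N}"
  have fin: "finite I" by (simp add: I_def)
  have cont: "continuous_on {0..} (R i)"
    and disk: "t \<ge> 0 \<Longrightarrow> R i t \<in> closure (so3_disk r)"
    and ode: "t > 0 \<Longrightarrow> (R i has_vector_derivative
        - ((1 / real N) *\<^sub>R (\<Sum>j\<in>I. so3_gradient (\<lambda>X. K X (R j t)) (R i t)))) (at t)"
    if "i \<in> I" for i t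
    using assms(12) that unfolding global_solution_def I_def by auto
  have SO3: "R i t \<in> SO3" and tr: "1 + 2 * cos r \<le> trace (R i t)" if "i \<in> I" "t \<ge> 0" for i t
    using closure_so3_disk[OF _ disk[OF that]] r by auto
  have "cos (2 * r) > 0" using r by (intro cos_gt_zero_pi) auto
  moreover have close: "1 + 2 * cos (2 * r) \<le> R i t \<bullet> R j t" if "i \<in> I" "j \<in> I" "t \<ge> 0" for i j t
    using r by (intro SO3_inner_ge SO3 tr that) auto
  ultimately have ge1: "1 \<le> R i t \<bullet> R j t" if "i \<in> I" "j \<in> I" "t \<ge> 0" for i j t
    using that by (smt (verit, best))
  define \<theta> where "\<theta> i j t = so3_dist (R i t) (R j t)" for i j t
  have \<theta>_le: "\<theta> i j t \<le> 2 * r" and \<theta>_nonneg: "0 \<le> \<theta> i j t" if "i \<in> I" "j \<in> I" "t \<ge> 0" for i j t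
  proof -
    note d = so3_dist_range[OF SO3[OF that(1,3)] SO3[OF that(2,3)], folded \<theta>_def]
    show "0 \<le> \<theta> i j t" by fact
    have "cos (2 * r) \<le> cos (\<theta> i j t)" using close[OF that] d(3) by simp
    then show "\<theta> i j t \<le> 2 * r"
      using d(1,2) r by (subst (asm) cos_mono_le_eq) auto
  qed
  define w where "w i j t = g' ((\<theta> i j t)\<^sup>2) * angle_sin_ratio (\<theta> i j t)" for i j t
  have w: "0 \<le> w i j t" if "i \<in> I" "j \<in> I" "t \<ge> 0" for i j t
  proof -
    have "(\<theta> i j t)\<^sup>2 \<le> (2 * r)\<^sup>2" using \<theta>_le[OF that] \<theta>_nonneg[OF that] by (intro power_mono)
    then have "c * real_power ((\<theta> i j t)\<^sup>2) \<alpha> \<le> g' ((\<theta> i j t)\<^sup>2)"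
      by (intro g') (auto simp: power_mult_distrib)
    moreover have "0 \<le> c * real_power ((\<theta> i j t)\<^sup>2) \<alpha>" using \<open>c > 0\<close> real_power_nonneg by simp
    moreover have "0 \<le> angle_sin_ratio (\<theta> i j t)"
      using \<theta>_le[OF that] \<theta>_nonneg[OF that] r
      by (auto simp: angle_sin_ratio_def intro!: divide_nonneg_nonneg sin_ge_zero)
    ultimately show ?thesis by (simp add: w_def)
  qed
  have flow: "(R i has_vector_derivative (1 / real N) *\<^sub>R (\<Sum>k\<in>I. w i k t *\<^sub>R so3_pull (R i t) (R k t))) (at t)"
    if "i \<in> I" "t > 0" for i t
  proof -
    have "so3_gradient (\<lambda>X. K X (R k t)) (R i t) = - (w i k t *\<^sub>R so3_pull (R i t) (R k t))" if "k \<in> I" for k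
    proof -
      have "so3_dist (R i t) (R k t) < pi"
        using \<theta>_le[OF \<open>i \<in> I\<close> that, of t] \<open>t > 0\<close> r unfolding \<theta>_def by simp
      then show ?thesis
        using so3_gradient_kernel[OF K g SO3[OF \<open>i \<in> I\<close>] SO3[OF that]] SO3[OF that] \<open>t > 0\<close>
        by (simp add: w_def \<theta>_def so3_pull_def)
    qed
    then have "(\<Sum>k\<in>I. so3_gradient (\<lambda>X. K X (R k t)) (R i t)) = - (\<Sum>k\<in>I. w i k t *\<^sub>R so3_pull (R i t) (R k t))"
      by (simp add: sum_negf)
    with ode[OF that] show ?thesis by simp
  qed
  \<comment> \<open>\<open>S i j\<close> is \<open>N\<close> times the contribution of the motion of \<open>R i\<close> to the derivative of \<open>R i \<bullet> R j\<close>.\<close>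
  define S where "S i j t = (\<Sum>k\<in>I. w i k t * (so3_pull (R i t) (R k t) \<bullet> R j t))" for i j t
  have T_deriv: "((\<lambda>t. R i t \<bullet> R j t) has_real_derivative (S i j t + S j i t) / real N) (at t)"
    if "i \<in> I" "j \<in> I" "t > 0" for i j t
  proof -
    have "((\<lambda>t. R i t \<bullet> R j t) has_vector_derivative
        R i t \<bullet> ((1 / real N) *\<^sub>R (\<Sum>k\<in>I. w j k t *\<^sub>R so3_pull (R j t) (R k t)))
        + ((1 / real N) *\<^sub>R (\<Sum>k\<in>I. w i k t *\<^sub>R so3_pull (R i t) (R k t))) \<bullet> R j t) (at t)"
      by (rule bounded_bilinear.has_vector_derivative[OF bounded_bilinear_inner flow flow]) (use that in auto)
    then show ?thesis
      unfolding has_real_derivative_iff_has_vector_derivative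
      by (rule has_vector_derivative_eq_rhs)
        (simp add: S_def inner_sum_left inner_sum_right inner_commute add_divide_distrib)
  qed
  \<comment> \<open>At a pair \<open>i\<close>, \<open>j\<close> of maximal distance this applies to every summand.\<close>
  have S_term: "0 \<le> w i k t * (so3_pull (R i t) (R k t) \<bullet> R j t)"
    if "i \<in> I" "j \<in> I" "k \<in> I" "t > 0" and min: "R i t \<bullet> R j t \<le> R k t \<bullet> R j t" for i j k t
    using that by (intro mult_nonneg_nonneg w inner_so3_pull_nonneg SO3 ge1) auto
  have ev: "\<forall>\<^sub>F t in at_top. L \<le> R i t \<bullet> R j t" if L: "1 \<le> L" "L < 3" and ij: "i \<in> I" "j \<in> I" for L i j
  proof -
    define \<delta> where "\<delta> = arccos ((L - 1) / 2)"
    define \<eta> where "\<eta> = 4 * c * real_power (\<delta>\<^sup>2) \<alpha> * \<delta> * sin \<delta>"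
    have \<delta>: "0 < \<delta>" "\<delta> < pi" using L arccos_lt_bounded[of "(L - 1) / 2"] by (auto simp: \<delta>_def)
    then have \<eta>: "0 < \<eta>"
      unfolding \<eta>_def using \<open>c > 0\<close> by (intro mult_pos_pos real_power_pos sin_gt_zero) auto
    \<comment> \<open>Half of the lower bound \<open>\<eta> / N\<close> for the derivative, so that the inequality is strict.\<close>
    define \<kappa> where "\<kappa> = \<eta> / (2 * real N)"
    have \<kappa>: "0 < \<kappa>" "\<kappa> < \<eta> / real N" using \<eta> N by (auto simp: \<kappa>_def field_simps)
    define u where "u = (\<lambda>(i, j) t. R i t \<bullet> R j t)"
    have grow: "min (0 + \<kappa> * \<tau>) L \<le> u (i, j) \<tau>" if "\<tau> \<ge> 0" for \<tau>
    proof (rule family_min_growth[where P = "I \<times> I"])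
      show "finite (I \<times> I)" "(i, j) \<in> I \<times> I" using ij fin by auto
      show "continuous_on {0..} (u p)" if "p \<in> I \<times> I" for p
        using that by (auto simp: u_def intro!: continuous_intros cont)
      show "0 \<le> u p 0" if "p \<in> I \<times> I" for p
        using that ge1[of _ _ 0] by (force simp: u_def intro: order_trans[of 0 1])
      show "0 \<le> \<kappa>" "0 \<le> \<tau>" using \<kappa> that by auto
      fix p t assume "p \<in> I \<times> I" and t: "0 < t" and min: "\<forall>q\<in>I \<times> I. u p t \<le> u q t" and le: "u p t \<le> L"
      then obtain a b where p: "p = (a, b)" "a \<in> I" "b \<in> I" by auto
      have min: "R a t \<bullet> R b t \<le> R k t \<bullet> R b t" "R b t \<bullet> R a t \<le> R k t \<bullet> R a t" if "k \<in> I" for k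
        using min that p by (auto simp: u_def inner_commute)
      \<comment> \<open>The term \<open>k = b\<close> alone gives the growth; the others are dropped.\<close>
      have "\<eta> \<le> w a b t * (so3_pull (R a t) (R b t) \<bullet> R b t)"
        using weighted_pull_lower_bound[OF SO3[of a t] SO3[of b t] r(2) \<theta>_le[of a b t, unfolded \<theta>_def] g' \<open>c > 0\<close> \<open>\<alpha> \<ge> 0\<close> L]
          le t p SO3[of a t] SO3[of b t]
        by (simp add: \<eta>_def \<delta>_def w_def \<theta>_def u_def inner_so3_pull_same)
      also have "\<dots> \<le> S a b t"
        unfolding S_def by (rule member_le_sum) (use p t min fin in \<open>auto intro!: S_term\<close>)
      finally have "\<eta> \<le> S a b t" .
      moreover have "0 \<le> S b a t"
        unfolding S_def by (intro sum_nonneg S_term) (use p t min in auto)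
      ultimately have "\<eta> / real N \<le> (S a b t + S b a t) / real N"
        using N by (intro divide_right_mono) auto
      then have "\<kappa> < (S a b t + S b a t) / real N" using \<kappa> by simp
      then show "\<exists>d>\<kappa>. (u p has_real_derivative d) (at t)"
        using T_deriv[OF p(2,3) t] by (auto simp: u_def p(1))
    qed
    have "\<forall>\<^sub>F \<tau> in at_top. max 0 (L / \<kappa>) \<le> \<tau>" by (rule eventually_ge_at_top)
    then show ?thesis
    proof eventually_elim
      case (elim \<tau>)
      then have "L \<le> \<kappa> * \<tau>" using \<kappa> by (simp add: divide_le_eq mult.commute)
      then show ?case using grow[of \<tau>] elim by (simp add: u_def)
    qed
  qed
  show ?thesis
  proof (intro ballI)
    fix i j assume "i \<in> {1..N}" "j \<in> {1..N}"
    then have ij: "i \<in> I" "j \<in> I" by (simp_all add: I_def)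
    have le3: "R i t \<bullet> R j t \<le> 3" if "t \<ge> 0" for t
      using that ij by (intro SO3_inner_bounds(1) SO3)
    have "((\<lambda>t. R i t \<bullet> R j t) \<longlongrightarrow> 3) at_top"
    proof (rule order_tendstoI)
      fix a :: real assume "a < 3"
      then have "1 \<le> max 1 ((a + 3) / 2)" "max 1 ((a + 3) / 2) < 3" "a < max 1 ((a + 3) / 2)"
        by (auto simp: less_max_iff_disj)
      with ev[OF this(1,2) ij] show "\<forall>\<^sub>F t in at_top. a < R i t \<bullet> R j t"
        by (auto elim: eventually_mono)
    next
      fix a :: real assume "3 < a"
      show "\<forall>\<^sub>F t in at_top. R i t \<bullet> R j t < a"
        using eventually_ge_at_top[of 0] by eventually_elim (rule le_less_trans[OF le3 \<open>3 < a\<close>])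
    qed
    then have "((\<lambda>t. (R i t \<bullet> R j t - 1) / 2) \<longlongrightarrow> (3 - 1) / 2) at_top"
      by (rule tendsto_divide[OF tendsto_diff[OF _ tendsto_const] tendsto_const]) simp
    then have lim: "((\<lambda>t. (R i t \<bullet> R j t - 1) / 2) \<longlongrightarrow> 1) at_top" by simp
    have "((\<lambda>t. arccos ((R i t \<bullet> R j t - 1) / 2)) \<longlongrightarrow> arccos 1) at_top"
    proof (rule continuous_on_tendsto_compose[OF continuous_on_arccos' lim])
      show "\<forall>\<^sub>F t in at_top. (R i t \<bullet> R j t - 1) / 2 \<in> {-1..1}"
        using eventually_ge_at_top[of 0]
      proof eventually_elim
        case (elim t)
        then show ?case using le3[of t] ge1[OF ij, of t] by simp
      qed
    qed simp
    then show "((\<lambda>t. so3_dist (R i t) (R j t)) \<longlongrightarrow> 0) at_top"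
      by (simp add: so3_dist_inner)
  qed
qed

end
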